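(* Let $F:\mathbb{R}^m\to\mathbb{R}^m$ be continuously differentiable and Lipschitz continuous with a constant $L>0$. Assume that $\mathrm{Sol}(\mathbb{R}^m,F)$ is nonempty and that there is $\zeta>0$ such that $$\zeta\,\mathrm{dist}(x,\mathrm{Sol}(\mathbb{R}^m,F))\le\|F(x)\|\qquad\text{for all }x\in\mathbb{R}^m.$$ For some $0<\gamma<1$, consider the system $$\dot x=-\left(\|F(x)\|^{-\gamma}+\|F(x)\|\right)\nabla F(x)^\top F(x)$$ (the right-hand side being $0$ when $F(x)=0$). Assume that there is $\eta>0$ such that, for every $x$ with $F(x)\neq0$, either $$\lambda_{\min}(\nabla F(x)\nabla F(x)^\top)\ge\eta,$$ or $$\lambda_{\min}(\nabla F(x)\nabla F(x)^\top)=0,\qquad \lambda_2(\nabla F(x)\nabla F(x)^\top)\ge\eta,$$ and $F(x)$ is orthogonal to the eigenspace of $\nabla F(x)\nabla F(x)^\top$ corresponding to the eigenvalue $0$. Then the set $\mathrm{Sol}(\mathbb{R}^m,F)$ is fixed-time stable for this system, with the settling-time bound $$\sup_{x(0)\in\mathbb{R}^m}T(x(0))\le\frac{2}{\eta}\,\frac{1+\gamma}{\gamma}.$$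
   Context: For $K\subseteq\mathbb{R}^m$ and $F:K\to\mathbb{R}^m$, $\mathrm{Sol}(K,F)=\{x^*\in K\mid \langle F(x^* ),x-x^*\rangle\ge 0\ \text{for all }x\in K\}$. $\nabla F(x)$ is the Jacobian matrix of $F$ at $x$. For a symmetric matrix $A$, $\lambda_{\min}(A)$ is its smallest eigenvalue and $\lambda_2(A)$ its second smallest eigenvalue. $\|\cdot\|$ is the Euclidean norm, $\mathrm{dist}(x,M)=\inf_{y\in M}\|x-y\|$, and $M_\delta=\{x\mid\mathrm{dist}(x,M)<\delta\}$. For a system $\dot x=f(x)$ with domain $\mathrm{dom}(f)\subseteq\mathbb{R}^m$: a set $M$ is positively invariant if $x(0)\in M$ implies $x(t)\in M$ for all $t\ge0$. $M$ is stable if for each $\varepsilon>0$ there is $\delta>0$ such that $x(t)\in M_\varepsilon$ for all $t\ge0$ and all $x(0)\in M_\delta\cap\mathrm{dom}(f)$. A closed positively invariant set $M$ is finite-time stable if it is stable and there is $\delta>0$ such that for every $x(0)\in (M_\delta\cap\mathrm{dom}(f))\setminus M$ there is a finite time $T(x(0))>0$ (the settling time) with $\lim_{t\to T(x(0))}\mathrm{dist}(x(t),M)=0$; it is globally finite-time stable if this holds for all initial points in $\mathrm{dom}(f)$ (the settling time being $0$ for $x(0)\in M$). A closed globally finite-time stable set $M$ is fixed-time stable if $\sup_{x(0)\in\mathrm{dom}(f)}T(x(0))<\infty$. Standing assumption: the vector field $f$ is continuous and the system has a unique solution $x:[0,+\infty)\to\mathbb{R}^m$ for every initial point in $\mathrm{dom}(f)$.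 *)

theory Defs
  imports "HOL-Analysis.Analysis"
begin

definition Sol :: "'a::real_inner set \<Rightarrow> ('a \<Rightarrow> 'a) \<Rightarrow> 'a set" where
  "Sol K F = {xs \<in> K. \<forall>x\<in>K. F xs \<bullet> (x - xs) \<ge> 0}"

definition eigenspace :: "real^'n^'n \<Rightarrow> real \<Rightarrow> (real^'n) set" where
  "eigenspace A c = {v. A *v v = c *\<^sub>R v}"

definition eigenvalues :: "real^'n^'n \<Rightarrow> real set" where
  "eigenvalues A = {c. \<exists>v\<in>eigenspace A c. v \<noteq> 0}"

text \<open>
  These are meant for symmetric matrices, which have a finite nonempty set of real eigenvalues.
  Eigenvalues are compared as elements of the spectrum, so \<open>lambda_2\<close> is the smallest eigenvalue
  different from \<open>lambda_min\<close>, irrespective of multiplicities. It is unspecified for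
  multiples of the identity matrix.
\<close>

definition lambda_min :: "real^'n^'n \<Rightarrow> real" where
  "lambda_min A = Min (eigenvalues A)"

definition lambda_2 :: "real^'n^'n \<Rightarrow> real" where
  "lambda_2 A = Min (eigenvalues A - {lambda_min A})"

text \<open>
  Solutions are total functions, of which only the restriction to the nonnegative times matters;
  at time \<open>0\<close> the derivative is one-sided. \<open>D\<close> is the domain of the vector field.
\<close>

definition is_solution :: "('a::real_normed_vector \<Rightarrow> 'a) \<Rightarrow> 'a set \<Rightarrow> (real \<Rightarrow> 'a) \<Rightarrow> bool" where
  "is_solution f D x \<longleftrightarrow>
     (\<forall>t\<ge>0. x t \<in> D \<and> (x has_vector_derivative f (x t)) (at t within {0..}))"

definition well_posed :: "('a::real_normed_vector \<Rightarrow> 'a) \<Rightarrow> 'a set \<Rightarrow> bool" where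
  "well_posed f D \<longleftrightarrow> continuous_on D f \<and>
     (\<forall>x0\<in>D. \<exists>x. is_solution f D x \<and> x 0 = x0 \<and>
        (\<forall>y. is_solution f D y \<and> y 0 = x0 \<longrightarrow> (\<forall>t\<ge>0. y t = x t)))"

text \<open>
  \<^const>\<open>infdist\<close> is the infimum of the distances, except that it is \<open>0\<close> for the empty set;
  the notions below are meant for nonempty \<open>M\<close>.
\<close>

definition nbhd :: "'a::metric_space set \<Rightarrow> real \<Rightarrow> 'a set" where
  "nbhd M \<delta> = {x. infdist x M < \<delta>}"

definition positively_invariant ::
    "('a::real_normed_vector \<Rightarrow> 'a) \<Rightarrow> 'a set \<Rightarrow> 'a set \<Rightarrow> bool" where
  "positively_invariant f D M \<longleftrightarrow>
     (\<forall>x. is_solution f D x \<and> x 0 \<in> M \<longrightarrow> (\<forall>t\<ge>0. x t \<in> M))"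

definition stable :: "('a::real_normed_vector \<Rightarrow> 'a) \<Rightarrow> 'a set \<Rightarrow> 'a set \<Rightarrow> bool" where
  "stable f D M \<longleftrightarrow>
     (\<forall>\<epsilon>>0. \<exists>\<delta>>0. \<forall>x. is_solution f D x \<and> x 0 \<in> nbhd M \<delta> \<inter> D \<longrightarrow>
        (\<forall>t\<ge>0. x t \<in> nbhd M \<epsilon>))"

definition settling_times ::
    "('a::real_normed_vector \<Rightarrow> 'a) \<Rightarrow> 'a set \<Rightarrow> 'a set \<Rightarrow> 'a \<Rightarrow> real set" where
  "settling_times f D M x0 =
     {T. T > 0 \<and> (\<exists>x. is_solution f D x \<and> x 0 = x0 \<and> ((\<lambda>t. infdist (x t) M) \<longlongrightarrow> 0) (at T))}"

definition finite_time_stable ::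
    "('a::real_normed_vector \<Rightarrow> 'a) \<Rightarrow> 'a set \<Rightarrow> 'a set \<Rightarrow> bool" where
  "finite_time_stable f D M \<longleftrightarrow>
     closed M \<and> positively_invariant f D M \<and> stable f D M \<and>
     (\<exists>\<delta>>0. \<forall>x0 \<in> (nbhd M \<delta> \<inter> D) - M. settling_times f D M x0 \<noteq> {})"

definition globally_finite_time_stable ::
    "('a::real_normed_vector \<Rightarrow> 'a) \<Rightarrow> 'a set \<Rightarrow> 'a set \<Rightarrow> bool" where
  "globally_finite_time_stable f D M \<longleftrightarrow>
     finite_time_stable f D M \<and> (\<forall>x0 \<in> D - M. settling_times f D M x0 \<noteq> {})"

text \<open>
  Since \<open>M\<close> is positively invariant, every time after the arrival of a solution at \<open>M\<close> belongs to
  \<^const>\<open>settling_times\<close>; the settling time is the first one.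
\<close>

definition settling_time ::
    "('a::real_normed_vector \<Rightarrow> 'a) \<Rightarrow> 'a set \<Rightarrow> 'a set \<Rightarrow> 'a \<Rightarrow> real" where
  "settling_time f D M x0 = (if x0 \<in> M then 0 else Inf (settling_times f D M x0))"

definition fixed_time_stable ::
    "('a::real_normed_vector \<Rightarrow> 'a) \<Rightarrow> 'a set \<Rightarrow> 'a set \<Rightarrow> bool" where
  "fixed_time_stable f D M \<longleftrightarrow>
     globally_finite_time_stable f D M \<and> bdd_above (settling_time f D M ` D)"

definition vfield :: "real \<Rightarrow> (real^'m \<Rightarrow> real^'m) \<Rightarrow> real^'m \<Rightarrow> real^'m" where
  "vfield \<gamma> F x = (if F x = 0 then 0 else
     - ((norm (F x) powr (- \<gamma>) + norm (F x)) *\<^sub>R (transpose (jacobian F (at x)) *v F x)))"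

definition gram :: "(real^'m \<Rightarrow> real^'m) \<Rightarrow> real^'m \<Rightarrow> real^'m^'m" where
  "gram F x = jacobian F (at x) ** transpose (jacobian F (at x))"

end

theory Submission
  imports Defs
begin

text \<open>
  Along a trajectory, \<open>r = norm (F x)\<close> satisfies
  \<open>r' \<le> - \<eta> (r powr (1 - \<gamma>) + r\<^sup>2)\<close> as long as \<open>r > 0\<close>, because the spectral assumption says
  that \<open>F x \<bullet> gram F x *v F x \<ge> \<eta> r\<^sup>2\<close>. The quadratic term makes \<open>1 / r\<close> grow at rate at least
  \<open>\<eta>\<close>, so \<open>r \<le> 1\<close> at time \<open>1 / \<eta>\<close> whatever the initial point; the sublinear term makes
  \<open>r powr \<gamma>\<close> decrease at rate at least \<open>\<gamma> \<eta>\<close>, so \<open>r\<close> vanishes after a further time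
  \<open>1 / (\<gamma> \<eta>)\<close>.
\<close>

section \<open>Extremal eigenvalues of symmetric matrices\<close>

lemma symmetric_matrix_inner:
  fixes A :: "real^'n^'n"
  assumes "transpose A = A"
  shows "v \<bullet> (A *v w) = (A *v v) \<bullet> w"
  using assms by (metis dot_lmul_matrix transpose_matrix_vector)

text \<open>Eigenvectors for distinct eigenvalues are orthogonal, and a pairwise orthogonal set in a
  Euclidean space is finite. Finiteness makes the \<open>Min\<close> in \<open>lambda_min\<close>
  and \<open>lambda_2\<close> a lower bound of the eigenvalues it ranges over.\<close>

lemma finite_eigenvalues:
  fixes A :: "real^'n^'n"
  assumes sym: "transpose A = A"
  shows "finite (eigenvalues A)"
proof -
  have "\<forall>c\<in>eigenvalues A. \<exists>v. A *v v = c *\<^sub>R v \<and> v \<noteq> 0"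
    by (auto simp: eigenvalues_def eigenspace_def)
  then obtain e where e: "\<And>c. c \<in> eigenvalues A \<Longrightarrow> A *v e c = c *\<^sub>R e c"
      "\<And>c. c \<in> eigenvalues A \<Longrightarrow> e c \<noteq> 0"
    by metis
  have orth: "e c \<bullet> e d = 0" if "c \<in> eigenvalues A" "d \<in> eigenvalues A" "c \<noteq> d" for c d
  proof -
    have "d * (e c \<bullet> e d) = c * (e c \<bullet> e d)"
      using symmetric_matrix_inner[OF sym, of "e c" "e d"] e that by simp
    with \<open>c \<noteq> d\<close> show ?thesis by simp
  qed
  have "inj_on e (eigenvalues A)"
    using orth e(2) by (metis inj_onI inner_eq_zero_iff)
  moreover have "finite (e ` eigenvalues A)"
    by (rule pairwise_orthogonal_imp_finite)
      (auto simp: pairwise_def orthogonal_def intro: orth)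
  ultimately show ?thesis
    using finite_imageD by blast
qed

text \<open>By compactness the Rayleigh quotient has a minimiser on the unit sphere of
  \<open>W\<close>, and this is an eigenvector. Allowing an invariant subspace lets
  \<open>W = UNIV\<close> serve \<open>lambda_min\<close> and the complement of the lowest
  eigenspace serve \<open>lambda_2\<close>.\<close>

lemma rayleigh_minimum:
  fixes A :: "real^'n^'n"
  assumes sym: "transpose A = A"
    and W: "subspace W" "W \<noteq> {0}"
    and inv: "\<And>v. v \<in> W \<Longrightarrow> A *v v \<in> W"
  obtains w c where "w \<in> W" "w \<noteq> 0" "A *v w = c *\<^sub>R w"
    "\<And>v. v \<in> W \<Longrightarrow> c * (v \<bullet> v) \<le> v \<bullet> (A *v v)"
proof -
  obtain z where z: "z \<in> W" "z \<noteq> 0"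
    using W subspace_0 by blast
  let ?S = "sphere 0 1 \<inter> W"
  have "compact ?S"
    by (intro compact_Int_closed compact_sphere closed_subspace W)
  moreover have "z /\<^sub>R norm z \<in> ?S"
    using z W(1) by (simp add: subspace_scale)
  moreover have "continuous_on ?S (\<lambda>v. v \<bullet> (A *v v))"
    by (intro continuous_intros matrix_vector_mult_linear_continuous_on)
  ultimately obtain w where w: "w \<in> ?S"
      and min: "\<And>v. v \<in> ?S \<Longrightarrow> w \<bullet> (A *v w) \<le> v \<bullet> (A *v v)"
    using continuous_attains_inf[of ?S "\<lambda>v. v \<bullet> (A *v v)"] by blast
  define c where "c = w \<bullet> (A *v w)"
  define q where "q v = v \<bullet> (A *v v) - c * (v \<bullet> v)" for v
  have "w \<bullet> w = 1"
    using w by (simp add: dot_square_norm)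
  have q: "0 \<le> q v" if "v \<in> W" for v
  proof (cases "v = 0")
    case False
    have "v /\<^sub>R norm v \<in> ?S"
      using False that W(1) by (simp add: subspace_scale)
    from min[OF this] have "c \<le> (v \<bullet> (A *v v)) / (norm v)\<^sup>2"
      by (simp add: c_def matrix_vector_mult_scaleR power2_eq_square field_simps)
    then show ?thesis
      using False by (simp add: q_def dot_square_norm field_simps)
  qed (simp add: q_def)
  \<comment> \<open>The residual of the eigenvalue equation; invariance keeps it in
    \<open>W\<close>, so it is an admissible direction of variation.\<close>
  define u where "u = A *v w - c *\<^sub>R w"
  have "u \<in> W"
    using w W(1) inv by (simp add: u_def subspace_diff subspace_scale)
  have expand: "q (w - t *\<^sub>R u) = t * (t * q u - 2 * (u \<bullet> u))" for t
  proof -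
    have "q (w - t *\<^sub>R u) = q w - 2 * t * (u \<bullet> (A *v w - c *\<^sub>R w)) + t\<^sup>2 * q u"
      using symmetric_matrix_inner[OF sym, of w u]
      by (simp add: q_def matrix_vector_mult_diff_distrib matrix_vector_mult_scaleR inner_diff
          inner_commute algebra_simps power2_eq_square)
    moreover have "q w = 0"
      using \<open>w \<bullet> w = 1\<close> by (simp add: q_def c_def)
    ultimately show ?thesis
      by (simp add: u_def[symmetric] algebra_simps power2_eq_square)
  qed
  \<comment> \<open>The nonnegative form \<open>q\<close> vanishes at \<open>w\<close>, hence so does its first variation \<open>-2 (u \<bullet> u)\<close>
    in the direction \<open>-u\<close>.\<close>
  have "u = 0"
  proof (rule ccontr)
    assume "u \<noteq> 0"
    then have "0 < u \<bullet> u" by simp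
    \<comment> \<open>As \<open>0 \<le> q u\<close>, the denominator is positive, and
      \<open>t * q u \<le> u \<bullet> u < 2 * (u \<bullet> u)\<close> makes the right-hand side of
      \<open>expand\<close> negative.\<close>
    define t where "t = (u \<bullet> u) / (q u + 1)"
    have "0 < t" and "t * q u \<le> u \<bullet> u"
      using \<open>0 < u \<bullet> u\<close> q[OF \<open>u \<in> W\<close>] by (auto simp: t_def field_simps)
    then have "q (w - t *\<^sub>R u) < 0"
      using \<open>0 < u \<bullet> u\<close> unfolding expand by (intro mult_pos_neg) linarith+
    moreover have "w - t *\<^sub>R u \<in> W"
      using w \<open>u \<in> W\<close> W(1) by (simp add: subspace_diff subspace_scale)
    ultimately show False
      using q by fastforce
  qed
  show thesis
  proof
    show "w \<in> W" "w \<noteq> 0" using w by auto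
    show "A *v w = c *\<^sub>R w" using \<open>u = 0\<close> by (simp add: u_def)
    show "c * (v \<bullet> v) \<le> v \<bullet> (A *v v)" if "v \<in> W" for v
      using q[OF that] by (simp add: q_def)
  qed
qed

text \<open>The minimum of the Rayleigh quotient over the whole space is itself an eigenvalue, hence
  at least \<open>lambda_min A\<close>.\<close>

lemma lambda_min_le_rayleigh:
  fixes A :: "real^'n^'n"
  assumes sym: "transpose A = A"
  shows "lambda_min A * (v \<bullet> v) \<le> v \<bullet> (A *v v)"
proof (cases "v = 0")
  case False
  then have "(UNIV :: (real^'n) set) \<noteq> {0}" by blast
  then obtain w c where w: "w \<noteq> 0" "A *v w = c *\<^sub>R w"
    and c: "c * (v \<bullet> v) \<le> v \<bullet> (A *v v)"
    using rayleigh_minimum[OF sym subspace_UNIV] by (metis UNIV_I)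
  have "c \<in> eigenvalues A"
    using w by (auto simp: eigenvalues_def eigenspace_def)
  then have "lambda_min A \<le> c"
    using finite_eigenvalues[OF sym] by (simp add: lambda_min_def)
  then show ?thesis
    using c by (meson inner_ge_zero mult_right_mono order_trans)
qed simp

text \<open>By symmetry the orthogonal complement of the lowest eigenspace is invariant, so the
  Rayleigh minimum over it is an eigenvalue. For a multiple of the identity, where
  \<open>lambda_2\<close> is unspecified, the orthogonality hypothesis forces
  \<open>v = 0\<close>.\<close>

lemma lambda_2_le_rayleigh:
  fixes A :: "real^'n^'n"
  assumes sym: "transpose A = A"
    and orth: "\<forall>u \<in> eigenspace A (lambda_min A). orthogonal v u"
  shows "lambda_2 A * (v \<bullet> v) \<le> v \<bullet> (A *v v)"
proof (cases "v = 0")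
  case False
  define m where "m = lambda_min A"
  define W where "W = {w. \<forall>u \<in> eigenspace A m. orthogonal u w}"
  have W: "subspace W"
    unfolding W_def by (rule subspace_orthogonal_to_vectors)
  have v: "v \<in> W"
    using orth by (auto simp: W_def m_def orthogonal_commute)
  then have "W \<noteq> {0}" using False by blast
  moreover have "A *v w \<in> W" if "w \<in> W" for w
    using that symmetric_matrix_inner[OF sym, of _ w]
    by (auto simp: W_def orthogonal_def eigenspace_def)
  ultimately obtain w c where w: "w \<in> W" "w \<noteq> 0" "A *v w = c *\<^sub>R w"
    and c: "c * (v \<bullet> v) \<le> v \<bullet> (A *v v)"
    using rayleigh_minimum[OF sym W] v by metis
  \<comment> \<open>Otherwise \<open>w\<close> would lie both in the eigenspace and in its
    complement, hence be orthogonal to itself.\<close>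
  have "c \<noteq> m"
    using w by (auto simp: W_def eigenspace_def orthogonal_def)
  then have "c \<in> eigenvalues A - {lambda_min A}"
    using w by (auto simp: m_def eigenvalues_def eigenspace_def)
  then have "lambda_2 A \<le> c"
    using finite_eigenvalues[OF sym] by (simp add: lambda_2_def)
  then show ?thesis
    using c by (meson inner_ge_zero mult_right_mono order_trans)
qed simp

lemma transpose_gram: "transpose (gram F x) = gram F x"
  by (simp add: gram_def matrix_transpose_mul)

section \<open>Solutions of autonomous systems\<close>

lemma is_solution_continuous_on:
  assumes "is_solution f D x"
  shows "continuous_on {0..} x"
  using assms unfolding is_solution_def
  by (intro continuous_on_eq_continuous_within[THEN iffD2] ballI)
    (auto intro: has_vector_derivative_continuous)

lemma is_solution_shift:
  assumes x: "is_solution f D x" and "0 \<le> s"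
  shows "is_solution f D (\<lambda>t. x (s + t))"
  unfolding is_solution_def
proof (intro allI impI conjI)
  fix t :: real assume "0 \<le> t"
  then show "x (s + t) \<in> D"
    using x \<open>0 \<le> s\<close> by (simp add: is_solution_def)
  have "(x has_vector_derivative f (x (s + t))) (at (s + t) within {0..})"
    using x \<open>0 \<le> s\<close> \<open>0 \<le> t\<close> by (simp add: is_solution_def)
  then have "(x has_vector_derivative f (x (s + t))) (at (s + t) within (\<lambda>t. s + t) ` {0..})"
    by (rule has_vector_derivative_within_subset) (use \<open>0 \<le> s\<close> in auto)
  moreover have "((\<lambda>t. s + t) has_vector_derivative 1) (at t within {0..})"
    by (auto intro!: derivative_eq_intros)
  ultimately show "((\<lambda>t. x (s + t)) has_vector_derivative f (x (s + t))) (at t within {0..})"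
    using vector_diff_chain_within[of "\<lambda>t. s + t" 1 t "{0..}" x "f (x (s + t))"]
    by (simp add: o_def)
qed

text \<open>The solution restarted at time \<open>s\<close> and the constant \<open>x s\<close>
  solve the same initial value problem, so uniqueness identifies them. A trajectory may reach an
  equilibrium in finite time but cannot leave it.\<close>

lemma well_posed_equilibrium:
  assumes wp: "well_posed f D"
    and x: "is_solution f D x" and "0 \<le> s" "f (x s) = 0" "s \<le> t"
  shows "x t = x s"
proof -
  have s: "x s \<in> D"
    using x \<open>0 \<le> s\<close> by (simp add: is_solution_def)
  then have "is_solution f D (\<lambda>_. x s)"
    using \<open>f (x s) = 0\<close> by (auto simp: is_solution_def)
  moreover note is_solution_shift[OF x \<open>0 \<le> s\<close>]
  ultimately have "\<forall>\<tau>\<ge>0. x (s + \<tau>) = x s"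
    using wp s unfolding well_posed_def by (metis (no_types, lifting) add.right_neutral)
  from this[rule_format, of "t - s"] show ?thesis
    using \<open>s \<le> t\<close> by simp
qed

section \<open>The flow\<close>

lemma Sol_UNIV: "Sol UNIV F = {x. F x = 0}"
proof (intro set_eqI iffI)
  fix x assume "x \<in> Sol UNIV F"
  \<comment> \<open>Testing with the point \<open>x - F x\<close> turns the variational inequality
    into \<open>0 \<le> - (F x \<bullet> F x)\<close>.\<close>
  then have "0 \<le> F x \<bullet> ((x - F x) - x)"
    unfolding Sol_def by blast
  then show "x \<in> {x. F x = 0}"
    by (auto simp: not_less[symmetric])
qed (simp add: Sol_def)

text \<open>With \<open>y = F x\<close>, \<open>r = norm y\<close> and
  \<open>k = r powr (- \<gamma>) + r\<close>, the chain rule gives the derivative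
  \<open>- (k / r) * (y \<bullet> (gram F x *v y))\<close>. Coercivity bounds it by
  \<open>- \<eta> * (k * r)\<close>, and \<open>k * r\<close> is the stated sum of powers.\<close>

lemma norm_vfield_flow_derivative:
  fixes F :: "real^'m \<Rightarrow> real^'m"
  assumes diff: "F differentiable (at (x t))"
    and x: "is_solution (vfield \<gamma> F) D x" and "0 < t" "F (x t) \<noteq> 0"
    and coercive: "\<eta> * (F (x t) \<bullet> F (x t)) \<le> F (x t) \<bullet> (gram F (x t) *v F (x t))"
  obtains d where "((\<lambda>t. norm (F (x t))) has_real_derivative d) (at t)"
    and "d \<le> - \<eta> * (norm (F (x t)) powr (1 - \<gamma>) + (norm (F (x t)))\<^sup>2)"
proof -
  define J where "J = jacobian F (at (x t))"
  define y where "y = F (x t)"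
  define r where "r = norm y"
  define k where "k = r powr (- \<gamma>) + r"
  have "0 < r" using \<open>F (x t) \<noteq> 0\<close> by (simp add: r_def y_def)
  have field: "vfield \<gamma> F (x t) = (- k) *\<^sub>R (transpose J *v y)"
    using \<open>F (x t) \<noteq> 0\<close> unfolding scaleR_minus_left
    by (simp add: vfield_def J_def y_def k_def r_def)
  have "(x has_vector_derivative vfield \<gamma> F (x t)) (at t within {0..})"
    using x \<open>0 < t\<close> by (simp add: is_solution_def)
  then have "(x has_vector_derivative vfield \<gamma> F (x t)) (at t)"
    using \<open>0 < t\<close> by (simp add: at_within_interior[of t "{0..}"])
  then have "(x has_derivative (\<lambda>h. h *\<^sub>R vfield \<gamma> F (x t))) (at t)"
    by (simp add: has_vector_derivative_def)
  moreover have "(F has_derivative (\<lambda>h. J *v h)) (at (x t))"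
    using diff jacobian_works unfolding J_def by blast
  ultimately have "((\<lambda>t. F (x t)) has_derivative (\<lambda>h. J *v (h *\<^sub>R vfield \<gamma> F (x t)))) (at t)"
    using has_derivative_compose by blast
  then have "((\<lambda>t. norm (F (x t))) has_derivative
      (\<lambda>h. (J *v (h *\<^sub>R vfield \<gamma> F (x t))) \<bullet> sgn y)) (at t)"
    unfolding y_def
    by (rule has_derivative_compose) (rule has_derivative_norm[OF \<open>F (x t) \<noteq> 0\<close>])
  moreover define d where "d = (J *v vfield \<gamma> F (x t)) \<bullet> sgn y"
  ultimately have "((\<lambda>t. norm (F (x t))) has_real_derivative d) (at t)"
    by (simp add: has_field_derivative_def matrix_vector_mult_scaleR mult_commute_abs)
  moreover have "d \<le> - \<eta> * (r powr (1 - \<gamma>) + r\<^sup>2)"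
  proof -
    have "d = - (k / r) * (y \<bullet> (gram F (x t) *v y))"
      by (simp add: d_def field gram_def J_def[symmetric] matrix_vector_mult_scaleR sgn_div_norm
          r_def[symmetric] matrix_vector_mul_assoc[symmetric] inner_commute divide_inverse
          del: scaleR_minus_left transpose_matrix_vector)
    also have "\<dots> \<le> - (k / r) * (\<eta> * (y \<bullet> y))"
      using coercive \<open>0 < r\<close> by (intro mult_left_mono_neg) (auto simp: y_def k_def)
    also have "\<dots> = - \<eta> * (k * r)"
      using \<open>0 < r\<close> by (simp add: dot_square_norm r_def[symmetric] power2_eq_square)
    also have "k * r = r powr (1 - \<gamma>) + r\<^sup>2"
      using \<open>0 < r\<close> by (simp add: k_def distrib_right power2_eq_square powr_diff powr_minus divide_inverse)
    finally show ?thesis .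
  qed
  ultimately show thesis
    using that by (simp add: r_def y_def)
qed

text \<open>Phases of lengths \<open>1 / \<eta>\<close> and \<open>1 / (\<gamma> * \<eta>)\<close>
  add up to the bound on \<open>T\<close>. Positivity on all of \<open>[0, T]\<close> makes
  \<open>inverse (r t)\<close> and \<open>r t powr \<gamma>\<close> legitimate comparison functions.
  The inequality is strict because positivity already fails at the bound itself.\<close>

lemma fixed_time_comparison:
  fixes r :: "real \<Rightarrow> real"
  assumes "0 < \<eta>" "0 < \<gamma>" and cont: "continuous_on {0..T} r"
    and pos: "\<And>t. 0 \<le> t \<Longrightarrow> t \<le> T \<Longrightarrow> 0 < r t"
    and deriv: "\<And>t. 0 < t \<Longrightarrow> t < T \<Longrightarrow> \<exists>d. (r has_real_derivative d) (at t) \<and>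
      d \<le> - \<eta> * (r t powr (1 - \<gamma>) + (r t)\<^sup>2)"
  shows "T < (1 + \<gamma>) / (\<gamma> * \<eta>)"
proof (rule ccontr)
  assume "\<not> T < (1 + \<gamma>) / (\<gamma> * \<eta>)"
  then have T: "1 / \<eta> + 1 / (\<gamma> * \<eta>) \<le> T"
    using assms by (simp add: field_simps)
  define s where "s = 1 / \<eta>"
  have "0 < s" and "s \<le> T"
    using T assms by (auto simp: s_def) (smt (verit) divide_pos_pos mult_pos_pos)
  \<comment> \<open>First phase: dropping the sublinear term leaves
    \<open>d \<le> - \<eta> * (r t)\<^sup>2\<close>, so \<open>inverse (r t)\<close> has derivative
    at least \<open>\<eta>\<close>.\<close>
  have "inverse (r 0) - \<eta> * 0 \<le> inverse (r s) - \<eta> * s"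
  proof (rule DERIV_nonneg_imp_increasing_open[of 0 s "\<lambda>t. inverse (r t) - \<eta> * t"])
    fix t assume t: "0 < t" "t < s"
    then obtain d where d: "(r has_real_derivative d) (at t)"
        "d \<le> - \<eta> * (r t powr (1 - \<gamma>) + (r t)\<^sup>2)"
      using deriv \<open>s \<le> T\<close> by (metis less_le_trans)
    have "0 < r t" using pos t \<open>s \<le> T\<close> by simp
    have "d \<le> - \<eta> * (r t)\<^sup>2"
      using d(2) \<open>0 < \<eta>\<close> by (smt (verit) mult_le_cancel_left_pos mult_minus_left powr_ge_zero)
    then have "0 \<le> - d / (r t)\<^sup>2 - \<eta>"
      using \<open>0 < r t\<close> by (simp add: field_simps)
    moreover have "((\<lambda>t. inverse (r t) - \<eta> * t) has_real_derivative - d / (r t)\<^sup>2 - \<eta>) (at t)"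
      using \<open>0 < r t\<close>
      by (auto intro!: derivative_eq_intros d(1) simp: power2_eq_square field_simps)
    ultimately show "\<exists>y. ((\<lambda>t. inverse (r t) - \<eta> * t) has_real_derivative y) (at t) \<and> 0 \<le> y"
      by blast
  next
    show "continuous_on {0..s} (\<lambda>t. inverse (r t) - \<eta> * t)"
      using \<open>s \<le> T\<close> pos
      by (intro continuous_intros continuous_on_subset[OF cont]) (auto simp: less_imp_neq[symmetric])
  qed (use \<open>0 < s\<close> in simp)
  then have "1 \<le> inverse (r s)"
    using pos[of 0] \<open>0 < s\<close> \<open>s \<le> T\<close> \<open>0 < \<eta>\<close> by (simp add: s_def) (smt (verit) positive_imp_inverse_positive)
  then have "r s \<le> 1"
    by (metis inverse_1 inverse_inverse_eq le_imp_inverse_le zero_less_one)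
  \<comment> \<open>Second phase: dropping the quadratic term, the powers of \<open>r t\<close>
    cancel in the derivative of \<open>r t powr \<gamma>\<close>.\<close>
  have "r T powr \<gamma> + \<gamma> * \<eta> * T \<le> r s powr \<gamma> + \<gamma> * \<eta> * s"
  proof (rule DERIV_nonpos_imp_decreasing_open[of s T "\<lambda>t. r t powr \<gamma> + \<gamma> * \<eta> * t"])
    fix t assume t: "s < t" "t < T"
    then obtain d where d: "(r has_real_derivative d) (at t)"
        "d \<le> - \<eta> * (r t powr (1 - \<gamma>) + (r t)\<^sup>2)"
      using deriv \<open>0 < s\<close> by (metis less_trans)
    have "0 < r t" using pos t \<open>0 < s\<close> by simp
    have "d \<le> - \<eta> * r t powr (1 - \<gamma>)"
      using d(2) \<open>0 < \<eta>\<close> by (smt (verit) mult_le_cancel_left_pos mult_minus_left zero_le_power2)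
    then have "\<gamma> * r t powr (\<gamma> - 1) * d \<le> \<gamma> * r t powr (\<gamma> - 1) * (- \<eta> * r t powr (1 - \<gamma>))"
      using \<open>0 < \<gamma>\<close> by (intro mult_left_mono) auto
    also have "\<dots> = - (\<gamma> * \<eta>) * (r t powr (\<gamma> - 1) * r t powr (1 - \<gamma>))"
      by simp
    also have "r t powr (\<gamma> - 1) * r t powr (1 - \<gamma>) = 1"
      using \<open>0 < r t\<close> by (simp add: powr_add[symmetric])
    finally have "\<gamma> * r t powr (\<gamma> - 1) * d + \<gamma> * \<eta> \<le> 0"
      by simp
    moreover have "((\<lambda>t. r t powr \<gamma> + \<gamma> * \<eta> * t) has_real_derivative
        \<gamma> * r t powr (\<gamma> - 1) * d + \<gamma> * \<eta>) (at t)"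
      using DERIV_add[OF DERIV_fun_powr[OF d(1) \<open>0 < r t\<close>, of \<gamma>] DERIV_cmult_Id[of "\<gamma> * \<eta>"]]
      by simp
    ultimately show "\<exists>y. ((\<lambda>t. r t powr \<gamma> + \<gamma> * \<eta> * t) has_real_derivative y) (at t) \<and> y \<le> 0"
      by blast
  next
    show "continuous_on {s..T} (\<lambda>t. r t powr \<gamma> + \<gamma> * \<eta> * t)"
      using \<open>0 < s\<close> pos
      by (intro continuous_intros continuous_on_subset[OF cont]) (auto simp: less_imp_neq[symmetric])
  qed (use \<open>s \<le> T\<close> in simp)
  \<comment> \<open>From a value of at most \<open>1\<close>, a decrease at rate
    \<open>\<gamma> * \<eta>\<close> over a time of at least \<open>1 / (\<gamma> * \<eta>)\<close>
    would give \<open>r T powr \<gamma> \<le> 0\<close>.\<close>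
  moreover have "r s powr \<gamma> \<le> 1"
    using \<open>r s \<le> 1\<close> pos[of s] \<open>0 < s\<close> \<open>s \<le> T\<close> \<open>0 < \<gamma>\<close> by (simp add: powr_le1)
  moreover have "\<gamma> * \<eta> * s + 1 \<le> \<gamma> * \<eta> * T"
    using T assms by (simp add: s_def field_simps)
  moreover have "0 < r T powr \<gamma>"
    using pos[of T] \<open>0 < s\<close> \<open>s \<le> T\<close> by simp
  ultimately show False by linarith
qed

theorem theorem3:
  fixes F :: "real^'m \<Rightarrow> real^'m" and L \<zeta> \<gamma> \<eta> :: real
  assumes diff: "\<And>x. F differentiable (at x)"
    and C1: "continuous_on UNIV (\<lambda>x. jacobian F (at x))"
    and L: "L > 0" "L-lipschitz_on UNIV F"
    and nonempty: "Sol UNIV F \<noteq> {}"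
    and zeta: "\<zeta> > 0" "\<And>x. \<zeta> * infdist x (Sol UNIV F) \<le> norm (F x)"
    and gamma: "0 < \<gamma>" "\<gamma> < 1"
    and wp: "well_posed (vfield \<gamma> F) UNIV"
    and eta: "\<eta> > 0"
    and spectral: "\<And>x. F x \<noteq> 0 \<Longrightarrow>
          lambda_min (gram F x) \<ge> \<eta> \<or>
          (lambda_min (gram F x) = 0 \<and> lambda_2 (gram F x) \<ge> \<eta> \<and>
           (\<forall>v \<in> eigenspace (gram F x) 0. orthogonal (F x) v))"
  shows "fixed_time_stable (vfield \<gamma> F) UNIV (Sol UNIV F) \<and>
         (SUP x0. settling_time (vfield \<gamma> F) UNIV (Sol UNIV F) x0) \<le> 2 / \<eta> * ((1 + \<gamma>) / \<gamma>)"
proof -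
  let ?f = "vfield \<gamma> F" and ?M = "Sol UNIV F"
  \<comment> \<open>The sum of the two phase lengths, and half of the claimed bound.\<close>
  define Ts where "Ts = (1 + \<gamma>) / (\<gamma> * \<eta>)"
  have "0 < Ts" using gamma eta by (simp add: Ts_def)
  have contF: "continuous_on A F" for A
    using L(2) by (meson continuous_on_subset lipschitz_on_continuous_on subset_UNIV)
  have closed: "closed ?M"
    unfolding Sol_UNIV using contF by (intro closed_Collect_eq) auto
  have coercive: "\<eta> * (F x \<bullet> F x) \<le> F x \<bullet> (gram F x *v F x)" if "F x \<noteq> 0" for x
  proof -
    have "\<eta> * (F x \<bullet> F x) \<le> l * (F x \<bullet> F x)" if "\<eta> \<le> l" for l
      using that by (simp add: mult_right_mono)
    \<comment> \<open>In the degenerate case the eigenspace for \<open>0\<close> is that of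
      \<open>lambda_min\<close>, so the \<open>lambda_2\<close> estimate applies to
      \<open>F x\<close>.\<close>
    then show ?thesis
      using spectral[OF that] lambda_min_le_rayleigh[OF transpose_gram, of F x "F x"]
        lambda_2_le_rayleigh[OF transpose_gram, of F x "F x"] by fastforce
  qed
  have deriv: "\<exists>d. ((\<lambda>t. norm (F (x t))) has_real_derivative d) (at t) \<and>
      d \<le> - \<eta> * (norm (F (x t)) powr (1 - \<gamma>) + (norm (F (x t)))\<^sup>2)"
    if "is_solution ?f UNIV x" "0 < t" "F (x t) \<noteq> 0" for x t
    using norm_vfield_flow_derivative[OF diff that coercive[OF that(3)]] by metis
  have contr: "continuous_on {0..T} (\<lambda>t. norm (F (x t)))" if "is_solution ?f UNIV x" for x T
    using is_solution_continuous_on[OF that]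
    by (intro continuous_on_norm continuous_on_compose2[OF contF[of UNIV]])
      (auto intro: continuous_on_subset)
  have absorb: "x t = x s"
    if "is_solution ?f UNIV x" "0 \<le> s" "s \<le> t" "F (x s) = 0" for x s t
    using well_posed_equilibrium[OF wp that(1,2) _ that(3)] that(4) by (simp add: vfield_def)
  have decreasing: "norm (F (x t)) \<le> norm (F (x 0))"
    if x: "is_solution ?f UNIV x" and "0 \<le> t" for x t
  proof (cases "F (x t) = 0")
    case False
    show ?thesis
    proof (rule DERIV_nonpos_imp_decreasing_open[OF \<open>0 \<le> t\<close> _ contr[OF x]])
      fix s assume "0 < s" "s < t"
      \<comment> \<open>A zero of \<open>F\<close> met before time \<open>t\<close> would persist
        until \<open>t\<close>.\<close>
      then have "F (x s) \<noteq> 0"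
        using absorb[OF x, of s t] False by auto
      from deriv[OF x \<open>0 < s\<close> this] obtain d
        where "((\<lambda>t. norm (F (x t))) has_real_derivative d) (at s)"
          and d: "d \<le> - \<eta> * (norm (F (x s)) powr (1 - \<gamma>) + (norm (F (x s)))\<^sup>2)"
        by blast
      moreover have "d \<le> 0"
        using d eta by (smt (verit) mult_minus_left mult_nonneg_nonneg powr_ge_zero zero_le_power2)
      ultimately show "\<exists>y. ((\<lambda>t. norm (F (x t))) has_real_derivative y) (at s) \<and> y \<le> 0"
        by blast
    qed
  qed simp
  have arrival: "F (x Ts) = 0" if x: "is_solution ?f UNIV x" for x
  proof (rule ccontr)
    assume "F (x Ts) \<noteq> 0"
    then have nz: "F (x t) \<noteq> 0" if "0 \<le> t" "t \<le> Ts" for t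
      using absorb[OF x that] by auto
    have "Ts < (1 + \<gamma>) / (\<gamma> * \<eta>)"
    proof (rule fixed_time_comparison[OF eta gamma(1) contr[OF x, of Ts]])
      show "0 < norm (F (x t))" if "0 \<le> t" "t \<le> Ts" for t
        using nz[OF that] by simp
      show "\<exists>d. ((\<lambda>t. norm (F (x t))) has_real_derivative d) (at t) \<and>
          d \<le> - \<eta> * (norm (F (x t)) powr (1 - \<gamma>) + (norm (F (x t)))\<^sup>2)"
        if "0 < t" "t < Ts" for t
        using that by (intro deriv x nz) auto
    qed
    then show False by (simp add: Ts_def)
  qed
  have invariant: "positively_invariant ?f UNIV ?M"
    unfolding positively_invariant_def Sol_UNIV
  proof (intro allI impI)
    fix x t assume "is_solution ?f UNIV x \<and> x 0 \<in> {x. F x = 0}" and "0 \<le> (t::real)"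
    then show "x t \<in> {x. F x = 0}"
      using absorb[of x 0 t] by simp
  qed
  have stable: "stable ?f UNIV ?M"
    unfolding stable_def
  proof (intro allI impI)
    fix e :: real assume "0 < e"
    have upper: "norm (F x) \<le> L * infdist x ?M" for x
    proof -
      obtain y where y: "y \<in> ?M" "infdist x ?M = dist x y"
        using infdist_attains_inf[OF closed nonempty] by blast
      then show ?thesis
        using lipschitz_onD[OF L(2), of x y] by (simp add: Sol_UNIV dist_norm)
    qed
    show "\<exists>\<delta>>0. \<forall>x. is_solution ?f UNIV x \<and> x 0 \<in> nbhd ?M \<delta> \<inter> UNIV \<longrightarrow>
        (\<forall>t\<ge>0. x t \<in> nbhd ?M e)"
    \<comment> \<open>The choice of \<open>\<delta>\<close> closes the chain \<open>\<zeta> *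
      infdist (x t) ?M \<le> norm (F (x t)) \<le> norm (F (x 0)) \<le> L * infdist (x 0) ?M <
      \<zeta> * e\<close>.\<close>
    proof (intro exI[of _ "e * \<zeta> / L"] conjI allI impI)
      fix x t assume x: "is_solution ?f UNIV x \<and> x 0 \<in> nbhd ?M (e * \<zeta> / L) \<inter> UNIV"
        and "0 \<le> (t::real)"
      have "\<zeta> * infdist (x t) ?M \<le> L * infdist (x 0) ?M"
        using zeta(2) decreasing upper x \<open>0 \<le> t\<close> by (meson order_trans)
      also have "\<dots> < \<zeta> * e"
        using x L(1) by (simp add: nbhd_def field_simps)
      finally show "x t \<in> nbhd ?M e"
        using zeta(1) by (simp add: nbhd_def)
    qed (use \<open>0 < e\<close> zeta L in simp)
  qed
  \<comment> \<open>One time serves all initial points. As \<open>0 < Ts\<close>, it is interior to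
    the half-line on which solutions are controlled, so the two-sided limit makes sense.\<close>
  have settles: "Ts \<in> settling_times ?f UNIV ?M x0" for x0
  proof -
    obtain x where x: "is_solution ?f UNIV x" "x 0 = x0"
      using wp unfolding well_posed_def by blast
    have "isCont x Ts"
      using is_solution_continuous_on[OF x(1)] \<open>0 < Ts\<close>
      by (intro continuous_on_interior[of "{0..}"]) auto
    then have "((\<lambda>t. infdist (x t) ?M) \<longlongrightarrow> infdist (x Ts) ?M) (at Ts)"
      by (intro tendsto_infdist) (simp add: isCont_def)
    moreover have "infdist (x Ts) ?M = 0"
      using arrival[OF x(1)] by (simp add: Sol_UNIV)
    ultimately show ?thesis
      using x \<open>0 < Ts\<close> by (auto simp: settling_times_def)
  qed
  have bound: "settling_time ?f UNIV ?M x0 \<le> Ts" for x0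
  proof -
    \<comment> \<open>The settling time is an infimum, so a lower bound of the set is required
      before membership of \<open>Ts\<close> bounds it from above.\<close>
    have "bdd_below (settling_times ?f UNIV ?M x0)"
      by (intro bdd_belowI[of _ 0]) (auto simp: settling_times_def)
    then show ?thesis
      using settles \<open>0 < Ts\<close> by (simp add: settling_time_def cInf_lower)
  qed
  have "fixed_time_stable ?f UNIV ?M"
    unfolding fixed_time_stable_def globally_finite_time_stable_def finite_time_stable_def
    using closed invariant stable settles bound
    by (auto intro!: exI[of _ 1] bdd_aboveI2)
  moreover have "(SUP x0. settling_time ?f UNIV ?M x0) \<le> Ts"
    using bound by (intro cSUP_least) auto
  moreover have "Ts \<le> 2 / \<eta> * ((1 + \<gamma>) / \<gamma>)"
    using gamma eta by (simp add: Ts_def field_simps)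
  ultimately show ?thesis by linarith
qed

end
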